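(* Let $A\in\mathbb{R}^{n\times n}$ be nonsingular and such that $A\bullet A$ has total support. Let $A_k$, $c_k$, $d_k$ be the iterates of the square-root Sinkhorn–Knopp algorithm applied to $A$ (described in the context). Then there exist diagonal matrices $\bar C,\bar D$ with strictly positive diagonals such that the sequence $$A_k=\operatorname{Diag}\Big(\prod_{j=1}^k\sqrt{c_j}\Big)\,A\,\operatorname{Diag}\Big(\prod_{j=1}^k\sqrt{d_j}\Big)$$ (products and square roots of vectors taken componentwise) converges linearly to $\bar A:=\bar C^{1/2}A\bar D^{1/2}$, and every row and every column of $\bar A$ has Euclidean norm $1$. Consequently, $\bar C$ and $\bar D$ satisfy the condition $$\begin{pmatrix}\operatorname{diag}(\bar CA\bar DA^T)\\ \operatorname{diag}(\bar DA^T\bar CA)\end{pmatrix}=\alpha e_{2n}\quad\text{for some }\alpha>0,$$ which is a necessary condition for a pair $(c,d)$, with $\bar C=\operatorname{Diag}(c)$, $\bar D=\operatorname{Diag}(d)$, to globally minimize $\omega\big((\operatorname{Diag}(c)^{1/2}A\operatorname{Diag}(d)^{1/2})^T(\operatorname{Diag}(c)^{1/2}A\operatorname{Diag}(d)^{1/2})\big)$ over $c,d\in\mathbb{R}^n_{++}$.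
   Context: $\bullet$ is the Hadamard product, $e_{2n}$ the all-ones vector of $\mathbb{R}^{2n}$, $\operatorname{Diag}(c)$ the diagonal matrix with diagonal $c$, $\operatorname{diag}(S)$ the vector of diagonal entries of $S$, $\mathbb{R}^n_{++}$ the vectors with strictly positive entries, and $\omega(S)=\dfrac{\operatorname{trace}(S)/n}{\det(S)^{1/n}}$ for symmetric positive definite $S$. A nonnegative square matrix $B=(b_{ij})$ has total support if $B\ne0$ and every nonzero entry of $B$ lies on a positive diagonal, i.e. for every $(i,j)$ with $b_{ij}>0$ there is a permutation $\sigma$ with $\sigma(i)=j$ and $b_{l,\sigma(l)}>0$ for all $l$. Square-root Sinkhorn–Knopp algorithm (run without stopping): $A_0=A$. For $k=1,2,\dots$: define $\sqrt{d_k}\in\mathbb{R}^n$ by $(\sqrt{d_k})_i=1/\|(A_{k-1})_{:,i}\|$ (reciprocal norm of the $i$-th column); set $\tilde A_k=A_{k-1}\operatorname{Diag}(\sqrt{d_k})$; define $\sqrt{c_k}\in\mathbb{R}^n$ by $(\sqrt{c_k})_i=1/\|(\tilde A_k)_{i,:}\|$ (reciprocal norm of the $i$-th row); set $A_k=\operatorname{Diag}(\sqrt{c_k})\tilde A_k$. Norms are Euclidean. "Converges linearly" means that there exist $\gamma>0$ and $\rho\in(0,1)$ with $\|A_k-\bar A\|\le\gamma\rho^k$ for all $k$. *)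

theory Defs
  imports "HOL-Analysis.Analysis"
begin

definition hadamard :: "real^'n^'m \<Rightarrow> real^'n^'m \<Rightarrow> real^'n^'m" where
  "hadamard A B = (\<chi> i j. A $ i $ j * B $ i $ j)"

definition Diag :: "real^'n \<Rightarrow> real^'n^'n" where
  "Diag c = (\<chi> i j. if i = j then c $ i else 0)"

definition diag :: "real^'n^'n \<Rightarrow> real^'n" where
  "diag S = (\<chi> i. S $ i $ i)"

definition pos_vec :: "real^'n \<Rightarrow> bool" where
  "pos_vec c \<longleftrightarrow> (\<forall>i. c $ i > 0)"

definition pos_diagonal :: "real^'n^'n \<Rightarrow> bool" where
  "pos_diagonal M \<longleftrightarrow> (\<forall>i j. i \<noteq> j \<longrightarrow> M $ i $ j = 0) \<and> pos_vec (diag M)"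

text \<open>The power 1/2 of a diagonal matrix with nonnegative diagonal; it is only applied to
  such matrices.\<close>

definition diag_sqrt :: "real^'n^'n \<Rightarrow> real^'n^'n" where
  "diag_sqrt M = Diag (\<chi> i. sqrt (M $ i $ i))"

definition total_support :: "real^'n^'n \<Rightarrow> bool" where
  "total_support B \<longleftrightarrow>
     (\<forall>i j. B $ i $ j \<ge> 0) \<and> B \<noteq> 0 \<and>
     (\<forall>i j. B $ i $ j > 0 \<longrightarrow>
        (\<exists>\<sigma>. \<sigma> permutes UNIV \<and> \<sigma> i = j \<and> (\<forall>l. B $ l $ \<sigma> l > 0)))"

definition recip_col_norms :: "real^'n^'n \<Rightarrow> real^'n" where
  "recip_col_norms B = (\<chi> i. 1 / norm (column i B))"

definition recip_row_norms :: "real^'n^'n \<Rightarrow> real^'n" where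
  "recip_row_norms B = (\<chi> i. 1 / norm (row i B))"

definition normalize_cols :: "real^'n^'n \<Rightarrow> real^'n^'n" where
  "normalize_cols B = B ** Diag (recip_col_norms B)"

definition normalize_rows :: "real^'n^'n \<Rightarrow> real^'n^'n" where
  "normalize_rows B = Diag (recip_row_norms B) ** B"

primrec sk_iter :: "real^'n^'n \<Rightarrow> nat \<Rightarrow> real^'n^'n" where
  "sk_iter A 0 = A"
| "sk_iter A (Suc k) = normalize_rows (normalize_cols (sk_iter A k))"

text \<open>The vectors $\sqrt{d_k}$ and $\sqrt{c_k}$ of step $k$; they are meaningful for
  $k \ge 1$ only. The algorithm specifies these square roots directly.\<close>

definition sk_sqrt_d :: "real^'n^'n \<Rightarrow> nat \<Rightarrow> real^'n" where
  "sk_sqrt_d A k = recip_col_norms (sk_iter A (k - 1))"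

definition sk_sqrt_c :: "real^'n^'n \<Rightarrow> nat \<Rightarrow> real^'n" where
  "sk_sqrt_c A k = recip_row_norms (normalize_cols (sk_iter A (k - 1)))"

text \<open>On \<^typ>\<open>real^'n^'n\<close> the library norm is the Frobenius norm.\<close>

definition converges_linearly :: "(nat \<Rightarrow> 'a::real_normed_vector) \<Rightarrow> 'a \<Rightarrow> bool" where
  "converges_linearly X L \<longleftrightarrow>
     (\<exists>\<gamma> \<rho>. \<gamma> > 0 \<and> 0 < \<rho> \<and> \<rho> < 1 \<and> (\<forall>k. norm (X k - L) \<le> \<gamma> * \<rho> ^ k))"

definition omega :: "real^'n^'n \<Rightarrow> real" where
  "omega S = (trace S / real CARD('n)) / (det S powr (1 / real CARD('n)))"

definition scaled_omega :: "real^'n^'n \<Rightarrow> real^'n \<Rightarrow> real^'n \<Rightarrow> real" where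
  "scaled_omega A c d =
     (let M = diag_sqrt (Diag c) ** A ** diag_sqrt (Diag d) in omega (transpose M ** M))"

text \<open>The index type \<^typ>\<open>'n + 'n\<close> has $2n$ elements.\<close>

definition stack :: "real^'n \<Rightarrow> real^'n \<Rightarrow> real^('n + 'n)" where
  "stack u v = (\<chi> k. case k of Inl i \<Rightarrow> u $ i | Inr i \<Rightarrow> v $ i)"

definition scaling_condition :: "real^'n^'n \<Rightarrow> real^'n^'n \<Rightarrow> real^'n^'n \<Rightarrow> bool" where
  "scaling_condition A C D \<longleftrightarrow>
     (\<exists>\<alpha>>0. stack (diag (C ** A ** D ** transpose A)) (diag (D ** transpose A ** C ** A))
            = \<alpha> *\<^sub>R (\<chi> k. 1))"

end

theory Submission
  imports Defs
begin

text \<open>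
  The entrywise squares \<open>B\<close> of the iterates follow the classical Sinkhorn--Knopp iteration, which is
  exact alternating minimisation of the convex function
  \<open>\<Sum>\<^sub>i\<^sub>j b\<^sub>i\<^sub>j exp (u\<^sub>i + v\<^sub>j) - \<Sum>\<^sub>i u\<^sub>i - \<Sum>\<^sub>j v\<^sub>j\<close>.
  Total support yields a doubly stochastic matrix \<open>p\<close> with the support of \<open>b\<close>, and the function becomes
  \<open>\<Sum>\<^sub>i\<^sub>j (b\<^sub>i\<^sub>j exp w\<^sub>i\<^sub>j - p\<^sub>i\<^sub>j w\<^sub>i\<^sub>j)\<close> with \<open>w\<^sub>i\<^sub>j = u\<^sub>i + v\<^sub>j\<close> on the support, which is
  coercive in \<open>w\<close>. A minimiser is a doubly stochastic scaling. Taking this scaling as the new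
  \<open>b = p\<close>, the excess over the minimum is \<open>\<Sum>\<^sub>i\<^sub>j p\<^sub>i\<^sub>j (exp w\<^sub>i\<^sub>j - 1 - w\<^sub>i\<^sub>j)\<close>. It is bounded by a
  multiple of the squared gradient on sublevel sets, while normalising the columns decreases it by
  at least such a multiple; hence it decays geometrically. It also dominates the squared Frobenius
  distance of the iterate to its limit.

  The necessary condition for minimality of \<open>\<omega>\<close> results from varying one scaling factor at a time.
\<close>

section \<open>Diagonal scalings and the product form of the iterates\<close>

lemma Diag_mult_component: "(Diag c ** M) $ i $ j = c $ i * M $ i $ j"
proof -
  have "(Diag c ** M) $ i $ j = (\<Sum>k\<in>UNIV. (if i = k then c $ i else 0) * M $ k $ j)"
    by (simp add: matrix_matrix_mult_def Diag_def)
  also have "\<dots> = (\<Sum>k\<in>UNIV. if i = k then c $ i * M $ k $ j else 0)"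
    by (intro sum.cong) auto
  finally show ?thesis by simp
qed

lemma mult_Diag_component: "(M ** Diag d) $ i $ j = M $ i $ j * d $ j"
proof -
  have "(M ** Diag d) $ i $ j = (\<Sum>k\<in>UNIV. M $ i $ k * (if k = j then d $ k else 0))"
    by (simp add: matrix_matrix_mult_def Diag_def)
  also have "\<dots> = (\<Sum>k\<in>UNIV. if k = j then M $ i $ k * d $ k else 0)"
    by (intro sum.cong) auto
  finally show ?thesis by simp
qed

lemma sk_iter_eq_scaling:
  "sk_iter A k =
     Diag (\<chi> i. \<Prod>j=1..k. sk_sqrt_c A j $ i) ** A ** Diag (\<chi> i. \<Prod>j=1..k. sk_sqrt_d A j $ i)"
proof (induction k)
  case 0
  show ?case by (simp add: vec_eq_iff mult_Diag_component Diag_mult_component)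
next
  case (Suc k)
  have *: "sk_iter A k $ i $ l
      = (\<Prod>j=1..k. sk_sqrt_c A j $ i) * A $ i $ l * (\<Prod>j=1..k. sk_sqrt_d A j $ l)" for i l
    by (subst Suc) (simp add: mult_Diag_component Diag_mult_component)
  have "sk_iter A (Suc k) $ i $ l
      = sk_sqrt_c A (Suc k) $ i * (sk_iter A k $ i $ l * sk_sqrt_d A (Suc k) $ l)" for i l
    by (simp add: normalize_rows_def normalize_cols_def sk_sqrt_c_def sk_sqrt_d_def
        mult_Diag_component Diag_mult_component)
  then show ?case
    by (simp add: vec_eq_iff mult_Diag_component Diag_mult_component * del: sk_iter.simps)
qed

section \<open>Scalar inequalities for the exponential\<close>

lemma exp_ge_one_plus_square:
  fixes z :: real
  assumes "\<bar>z\<bar> \<le> M"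
  shows "exp (- M) / 2 * z\<^sup>2 \<le> exp z - 1 - z"
proof -
  \<comment> \<open>The second-order Lagrange remainder: its factor \<open>exp t\<close> is at least
    \<open>exp (- M)\<close>, which amounts to strong convexity on a bounded interval.\<close>
  obtain t where t: "\<bar>t\<bar> \<le> \<bar>z\<bar>" "exp z = (\<Sum>m<2. z ^ m / fact m) + exp t / fact 2 * z ^ 2"
    using Maclaurin_exp_le[of z 2] by blast
  have "exp z - 1 - z = exp t / 2 * z\<^sup>2"
    using t(2) by (simp add: numeral_2_eq_2)
  moreover have "exp (- M) \<le> exp t"
    using t(1) assms by simp
  ultimately show ?thesis
    by (simp add: mult_right_mono)
qed

lemma exp_minus_one_minus_nonneg: "0 \<le> exp z - 1 - (z :: real)"
  using exp_ge_add_one_self[of z] by linarith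

text \<open>Turns a bound on \<open>exp z - 1 - z\<close> into a bound on \<open>z\<close>, which
  later makes sublevel sets bounded. For nonnegative \<open>z\<close> it combines the quadratic
  Taylor bound with the nonnegativity of the square of \<open>z - 1\<close>.\<close>

lemma abs_le_exp_minus: "\<bar>z\<bar> \<le> exp z - 1 - z + (1 :: real)"
proof (cases "0 \<le> z")
  case True
  have "1 + z + z\<^sup>2 / 2 \<le> exp z" by (rule exp_lower_Taylor_quadratic[OF True])
  moreover have "0 \<le> (z - 1)\<^sup>2" by simp
  then have "2 * z - 1 \<le> z\<^sup>2" by (simp add: power2_eq_square algebra_simps)
  ultimately show ?thesis using True by simp
next
  case False
  then show ?thesis using exp_gt_zero[of z] by linarith
qed

text \<open>Convexity of \<open>exp z - 1 - z\<close>: its height above the minimum at 0 is at most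
  slope times distance. This is the tangent bound at \<open>- z\<close> multiplied by
  \<open>exp z\<close>.\<close>

lemma exp_minus_one_minus_le: "exp z - 1 - z \<le> (exp z - 1) * (z :: real)"
proof -
  have "exp z * (1 - z) \<le> exp z * exp (- z)"
    using exp_ge_add_one_self[of "- z"] by (intro mult_left_mono) auto
  then show ?thesis by (simp add: exp_minus algebra_simps)
qed

text \<open>Expand the square and apply the tangent bound to \<open>exp (z / 2)\<close>. The left
  side is the squared relative change of a matrix entry whose square is multiplied by
  \<open>exp z\<close>.\<close>

lemma exp_half_minus_one_square_le: "(exp (z / 2) - 1)\<^sup>2 \<le> exp z - 1 - (z :: real)"
proof -
  have "(exp (z / 2) - 1)\<^sup>2 = exp z - 2 * exp (z / 2) + 1"
    by (simp add: power2_eq_square algebra_simps flip: exp_add)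
  then show ?thesis using exp_ge_add_one_self[of "z / 2"] by linarith
qed

lemma abs_exp_minus_one_le:
  fixes t :: real
  assumes "\<bar>t\<bar> \<le> M"
  shows "\<bar>exp t - 1\<bar> \<le> exp M * \<bar>t\<bar>"
proof (cases "0 \<le> t")
  case True
  have "exp t - 1 \<le> exp t * t"
    using exp_minus_one_minus_le[of t] by (simp add: algebra_simps)
  also have "\<dots> \<le> exp M * t" using True assms by (intro mult_right_mono) auto
  finally show ?thesis using True by simp
next
  case False
  have "1 - exp t \<le> 1 * - t" using exp_ge_add_one_self[of t] by linarith
  also have "\<dots> \<le> exp M * - t" using False assms by (intro mult_right_mono) auto
  finally show ?thesis using False by simp
qed

text \<open>The tangent line of the exponential at the point where \<open>b * exp\<close> has slope \<open>2 * p\<close>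
  gives linear growth to the right.\<close>

lemma exp_linear_coercive:
  fixes b p w :: real
  assumes "0 < b" "0 < p"
  shows "p * \<bar>w\<bar> \<le> b * exp w - p * w + 2 * p * \<bar>1 - ln (2 * p / b)\<bar>"
proof (cases "0 \<le> w")
  case True
  define s where "s = ln (2 * p / b)"
  have s: "b * exp s = 2 * p" using assms by (simp add: s_def)
  have "b * exp w = b * exp s * exp (w - s)" by (simp flip: exp_add)
  also have "\<dots> \<ge> 2 * p * (1 + (w - s))"
    unfolding s using assms exp_ge_add_one_self[of "w - s"] by (intro mult_left_mono) auto
  finally have "2 * p * w + 2 * p * (1 - s) \<le> b * exp w" by (simp add: algebra_simps)
  moreover have "- (2 * p * \<bar>1 - s\<bar>) \<le> 2 * p * (1 - s)"
    using assms mult_left_mono[of "- \<bar>1 - s\<bar>" "1 - s" "2 * p"] by simp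
  ultimately show ?thesis using True unfolding s_def by simp
next
  case False
  have "0 \<le> b * exp w" "0 \<le> 2 * p * \<bar>1 - ln (2 * p / b)\<bar>" using assms by simp_all
  then show ?thesis using False by simp
qed

section \<open>Positive entries, doubly stochastic matrices and total support\<close>

lemma ex_pos_lower_bound:
  fixes P :: "real^'n^'m"
  obtains q where "0 < q" "\<And>i j. 0 < P $ i $ j \<Longrightarrow> q \<le> P $ i $ j"
proof
  \<comment> \<open>The inserted 1 keeps the set nonempty when no entry is positive.\<close>
  let ?S = "insert 1 {P $ i $ j | i j. 0 < P $ i $ j}"
  have eq: "{P $ i $ j | i j. 0 < P $ i $ j} \<subseteq> (\<lambda>(i, j). P $ i $ j) ` UNIV" by auto
  have fin: "finite ?S" using finite_subset[OF eq] by simp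
  show "0 < Min ?S" using fin by (subst Min_gr_iff) auto
  show "Min ?S \<le> P $ i $ j" if "0 < P $ i $ j" for i j
    using that by (intro Min_le[OF fin]) auto
qed

definition doubly_stochastic :: "real^'n^'n \<Rightarrow> bool" where
  "doubly_stochastic P \<longleftrightarrow> (\<forall>i j. 0 \<le> P $ i $ j) \<and>
     (\<forall>i. (\<Sum>j\<in>UNIV. P $ i $ j) = 1) \<and> (\<forall>j. (\<Sum>i\<in>UNIV. P $ i $ j) = 1)"

lemma doubly_stochastic_transpose: "doubly_stochastic P \<Longrightarrow> doubly_stochastic (transpose P)"
  by (simp add: doubly_stochastic_def transpose_def)

text \<open>Unit row and column sums allow the linear terms of the potential to be spread over the
  edges with weights \<open>P\<close>.\<close>

lemma doubly_stochastic_sum: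
  assumes "doubly_stochastic P"
  shows "(\<Sum>i\<in>UNIV. \<Sum>j\<in>UNIV. P $ i $ j * (u $ i + v $ j)) = (\<Sum>i\<in>UNIV. u $ i) + (\<Sum>j\<in>UNIV. v $ j)"
proof -
  have "(\<Sum>i\<in>UNIV. \<Sum>j\<in>UNIV. P $ i $ j * u $ i) = (\<Sum>i\<in>UNIV. u $ i)"
    using assms by (simp add: doubly_stochastic_def flip: sum_distrib_right)
  moreover have "(\<Sum>i\<in>UNIV. \<Sum>j\<in>UNIV. P $ i $ j * v $ j) = (\<Sum>j\<in>UNIV. v $ j)"
    using assms by (subst sum.swap) (simp add: doubly_stochastic_def flip: sum_distrib_right)
  ultimately show ?thesis by (simp add: distrib_left sum.distrib)
qed

text \<open>Averaging the permutation matrices that witness total support.\<close>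

lemma total_support_doubly_stochastic:
  assumes "total_support B"
  obtains p where "doubly_stochastic p" "\<And>i j. 0 < p $ i $ j \<longleftrightarrow> 0 < B $ i $ j"
proof -
  define E where "E = {e. 0 < B $ fst e $ snd e}"
  obtain i j where "B $ i $ j \<noteq> 0"
    using assms unfolding total_support_def vec_eq_iff by fastforce
  moreover have "0 \<le> B $ i $ j" using assms by (simp add: total_support_def)
  ultimately have "(i, j) \<in> E" by (simp add: E_def)
  then have card: "0 < card E" "E \<noteq> {}" by (auto simp: card_gt_0_iff)
  have "\<forall>e\<in>E. \<exists>\<sigma>. \<sigma> permutes UNIV \<and> \<sigma> (fst e) = snd e \<and> (\<forall>l. 0 < B $ l $ \<sigma> l)"
    using assms by (auto simp: total_support_def E_def)
  then obtain s where s: "\<And>e. e \<in> E \<Longrightarrow> s e permutes UNIV"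
      "\<And>e. e \<in> E \<Longrightarrow> s e (fst e) = snd e" "\<And>e l. e \<in> E \<Longrightarrow> 0 < B $ l $ s e l"
    by metis
  define p :: "real^'a^'a" where "p = (\<chi> i j. (\<Sum>e\<in>E. of_bool (s e i = j)) / card E)"
  show ?thesis
  proof
    have "(\<Sum>j\<in>UNIV. p $ i $ j) = 1" for i
    proof -
      have "(\<Sum>j\<in>UNIV. \<Sum>e\<in>E. of_bool (s e i = j)) = real (card E)"
        by (subst sum.swap) (simp add: of_bool_def)
      then show ?thesis using card by (simp add: p_def flip: sum_divide_distrib)
    qed
    moreover have "(\<Sum>i\<in>UNIV. p $ i $ j) = 1" for j
    proof -
      have "(\<Sum>i\<in>UNIV. of_bool (s e i = j)) = (1 :: real)" if "e \<in> E" for e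
        using sum.permute[OF s(1)[OF that], of "\<lambda>i. of_bool (i = j) :: real"]
        by (simp add: o_def of_bool_def)
      then have "(\<Sum>i\<in>UNIV. \<Sum>e\<in>E. of_bool (s e i = j)) = real (card E)"
        by (subst sum.swap) simp
      then show ?thesis using card by (simp add: p_def flip: sum_divide_distrib)
    qed
    moreover have "0 \<le> p $ i $ j" for i j by (simp add: p_def sum_nonneg)
    ultimately show "doubly_stochastic p" by (simp add: doubly_stochastic_def)
    show "0 < p $ i $ j \<longleftrightarrow> 0 < B $ i $ j" for i j
    proof
      assume "0 < B $ i $ j"
      then have e: "(i, j) \<in> E" by (simp add: E_def)
      have "0 < (\<Sum>e\<in>E. of_bool (s e i = j) :: real)"
        using s(2)[OF e] by (intro sum_pos2[OF _ e]) auto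
      then show "0 < p $ i $ j" using card by (simp add: p_def)
    next
      assume "0 < p $ i $ j"
      then have "(\<Sum>e\<in>E. of_bool (s e i = j) :: real) \<noteq> 0" by (auto simp: p_def)
      then obtain e where "e \<in> E" "of_bool (s e i = j) \<noteq> (0 :: real)" by (meson sum.neutral)
      then show "0 < B $ i $ j" using s(3)[of e i] by (simp split: if_splits)
    qed
  qed
qed

section \<open>The potential and its alternating minimisation\<close>

definition row_sum :: "real^'n^'n \<Rightarrow> real^'n \<Rightarrow> real^'n \<Rightarrow> 'n \<Rightarrow> real" where
  "row_sum B u v i = (\<Sum>j\<in>UNIV. B $ i $ j * exp (u $ i + v $ j))"

definition potential :: "real^'n^'n \<Rightarrow> real^'n \<Rightarrow> real^'n \<Rightarrow> real" where
  "potential B u v = (\<Sum>i\<in>UNIV. row_sum B u v i) - (\<Sum>i\<in>UNIV. u $ i) - (\<Sum>j\<in>UNIV. v $ j)"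

text \<open>For fixed \<open>v\<close>, the derivative of the potential in \<open>u $ i\<close> is
  \<open>row_sum B u v i - 1\<close>; this update makes all of them vanish when the row sums are
  positive. The column update is the same map for \<open>transpose B\<close> with \<open>u\<close>
  and \<open>v\<close> exchanged.\<close>

definition row_update :: "real^'n^'n \<Rightarrow> real^'n \<Rightarrow> real^'n \<Rightarrow> real^'n" where
  "row_update B u v = (\<chi> i. u $ i - ln (row_sum B u v i))"

lemma row_sum_pos:
  assumes "\<And>i j. 0 \<le> B $ i $ j" "0 < B $ i $ j"
  shows "0 < row_sum B u v i"
  unfolding row_sum_def using assms by (intro sum_pos2[of _ j]) auto

lemma row_sum_transpose: "row_sum (transpose B) v u j = (\<Sum>i\<in>UNIV. B $ i $ j * exp (u $ i + v $ j))"
  by (simp add: row_sum_def transpose_def add.commute)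

lemma potential_transpose: "potential (transpose B) v u = potential B u v"
  unfolding potential_def row_sum_transpose
  by (subst sum.swap) (simp add: row_sum_def)

lemma row_sum_row_update:
  assumes "0 < row_sum B u v i"
  shows "row_sum B (row_update B u v) v i = 1"
proof -
  have "row_sum B (row_update B u v) v i = (\<Sum>j\<in>UNIV. B $ i $ j * exp (u $ i + v $ j) / row_sum B u v i)"
    unfolding row_sum_def[of B "row_update B u v"] using assms
    by (intro sum.cong) (simp_all add: row_update_def exp_add exp_diff)
  also have "\<dots> = row_sum B u v i / row_sum B u v i"
    by (simp add: row_sum_def flip: sum_divide_distrib)
  finally show ?thesis using assms by simp
qed

text \<open>Each row sum \<open>s\<close> becomes 1 while \<open>u $ i\<close> drops by
  \<open>ln s\<close>, so row \<open>i\<close> contributes a decrease of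
  \<open>s - 1 - ln s\<close>.\<close>

lemma potential_row_update:
  assumes "\<And>i. 0 < row_sum B u v i"
  shows "potential B (row_update B u v) v
       = potential B u v - (\<Sum>i\<in>UNIV. row_sum B u v i - 1 - ln (row_sum B u v i))"
  by (simp add: potential_def row_sum_row_update[OF assms] sum_subtractf)
    (simp add: row_update_def sum_subtractf)

lemma ln_gap_nonneg: "0 < x \<Longrightarrow> 0 \<le> x - 1 - ln (x :: real)"
  using ln_le_minus_one[of x] by simp

lemma potential_row_update_le:
  assumes "\<And>i. 0 < row_sum B u v i"
  shows "potential B (row_update B u v) v \<le> potential B u v"
  unfolding potential_row_update[OF assms]
  by (simp add: sum_nonneg[OF ln_gap_nonneg[OF assms]])

text \<open>A row update cannot decrease a minimal potential, so every gap
  \<open>s - 1 - ln s\<close> vanishes, and this happens only at \<open>s = 1\<close>.\<close>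

lemma row_sum_eq_1_if_minimal:
  assumes pos: "\<And>i. 0 < row_sum B u v i"
    and min: "\<And>u'. potential B u v \<le> potential B u' v"
  shows "row_sum B u v i = 1"
proof -
  have "(\<Sum>i\<in>UNIV. row_sum B u v i - 1 - ln (row_sum B u v i)) \<le> 0"
    using min[of "row_update B u v"] potential_row_update[OF pos] by simp
  moreover have gap: "0 \<le> row_sum B u v i - 1 - ln (row_sum B u v i)" for i
    by (rule ln_gap_nonneg[OF pos])
  moreover from gap have "0 \<le> (\<Sum>i\<in>UNIV. row_sum B u v i - 1 - ln (row_sum B u v i))"
    by (intro sum_nonneg)
  ultimately have "row_sum B u v i - 1 - ln (row_sum B u v i) = 0"
    using sum_nonneg_eq_0_iff[of UNIV "\<lambda>i. row_sum B u v i - 1 - ln (row_sum B u v i)"] by simp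
  then show ?thesis using ln_eq_minus_one[OF pos] by simp
qed

text \<open>On the support the potential depends on \<open>(u, v)\<close> only through this linear map, which
  is what makes it coercive and strongly convex despite its directions of invariance.\<close>

definition edge_sum :: "real^'n^'n \<Rightarrow> (real^'n) \<times> (real^'n) \<Rightarrow> real^'n^'n" where
  "edge_sum B x = (\<chi> i j. if B $ i $ j = 0 then 0 else fst x $ i + snd x $ j)"

lemma linear_edge_sum: "linear (edge_sum B)"
  by (rule linearI) (auto simp: edge_sum_def vec_eq_iff algebra_simps)

lemma norm_matrix_le_sum: "norm (w :: real^'n^'m) \<le> (\<Sum>i\<in>UNIV. \<Sum>j\<in>UNIV. \<bar>w $ i $ j\<bar>)"
proof -
  have "norm w \<le> (\<Sum>i\<in>UNIV. norm (w $ i))" by (simp add: norm_vec_def L2_set_le_sum)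
  also have "\<dots> \<le> (\<Sum>i\<in>UNIV. \<Sum>j\<in>UNIV. \<bar>w $ i $ j\<bar>)"
    by (intro sum_mono norm_le_l1_cart)
  finally show ?thesis .
qed

lemma norm_matrix_square: "(norm (w :: real^'n^'m))\<^sup>2 = (\<Sum>i\<in>UNIV. \<Sum>j\<in>UNIV. (w $ i $ j)\<^sup>2)"
  by (simp add: norm_vec_def L2_set_def sum_nonneg)

section \<open>Existence of a minimiser and of a doubly stochastic scaling\<close>

lemma total_support_ex_minimizer:
  assumes ts: "total_support B"
  obtains u v where "\<And>u' v'. potential B u v \<le> potential B u' v'"
proof -
  obtain p where ds: "doubly_stochastic p" and supp: "\<And>i j. 0 < p $ i $ j \<longleftrightarrow> 0 < B $ i $ j"
    using total_support_doubly_stochastic[OF ts] by blast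
  have nonneg: "0 \<le> B $ i $ j" "0 \<le> p $ i $ j" for i j
    using ts ds by (auto simp: total_support_def doubly_stochastic_def)
  have p0: "p $ i $ j = 0" if "B $ i $ j = 0" for i j
    using supp[of i j] nonneg[of i j] that by auto
  \<comment> \<open>The potential as a function of the edge sums. Entries outside the support
    contribute 0, as \<open>B\<close> and \<open>p\<close> both vanish there.\<close>
  define \<Psi> where "\<Psi> w = (\<Sum>i\<in>UNIV. \<Sum>j\<in>UNIV. B $ i $ j * exp (w $ i $ j) - p $ i $ j * w $ i $ j)"
    for w :: "real^'a^'a"
  have \<Psi>: "\<Psi> (edge_sum B (u, v)) = potential B u v" for u v
  proof -
    have "\<Psi> (edge_sum B (u, v)) = (\<Sum>i\<in>UNIV. \<Sum>j\<in>UNIV. B $ i $ j * exp (u $ i + v $ j)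
        - p $ i $ j * (u $ i + v $ j))"
      unfolding \<Psi>_def by (intro sum.cong refl) (auto simp: edge_sum_def p0)
    then show ?thesis
      by (simp add: sum_subtractf doubly_stochastic_sum[OF ds] potential_def row_sum_def)
  qed
  obtain q where q: "0 < q" "\<And>i j. 0 < p $ i $ j \<Longrightarrow> q \<le> p $ i $ j"
    using ex_pos_lower_bound[of p] by blast
  \<comment> \<open>The sum of the additive constants in \<open>exp_linear_coercive\<close>.\<close>
  define K where "K = (\<Sum>i\<in>UNIV. \<Sum>j\<in>UNIV. 2 * p $ i $ j * \<bar>1 - ln (2 * p $ i $ j / B $ i $ j)\<bar>)"
  have bound: "q * norm w \<le> \<Psi> w + K" if "w \<in> range (edge_sum B)" for w
  proof -
    have "q * norm w \<le> q * (\<Sum>i\<in>UNIV. \<Sum>j\<in>UNIV. \<bar>w $ i $ j\<bar>)"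
      using q(1) norm_matrix_le_sum by (intro mult_left_mono) auto
    also have "\<dots> = (\<Sum>i\<in>UNIV. \<Sum>j\<in>UNIV. q * \<bar>w $ i $ j\<bar>)" by (simp add: sum_distrib_left)
    also have "\<dots> \<le> (\<Sum>i\<in>UNIV. \<Sum>j\<in>UNIV. B $ i $ j * exp (w $ i $ j) - p $ i $ j * w $ i $ j
        + 2 * p $ i $ j * \<bar>1 - ln (2 * p $ i $ j / B $ i $ j)\<bar>)"
    proof (intro sum_mono)
      fix i j
      show "q * \<bar>w $ i $ j\<bar> \<le> B $ i $ j * exp (w $ i $ j) - p $ i $ j * w $ i $ j
        + 2 * p $ i $ j * \<bar>1 - ln (2 * p $ i $ j / B $ i $ j)\<bar>"
      proof (cases "B $ i $ j = 0")
        case True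
        then show ?thesis using that p0[OF True] by (auto simp: edge_sum_def)
      next
        case False
        then have B: "0 < B $ i $ j" using nonneg(1)[of i j] by simp
        then have P: "0 < p $ i $ j" by (simp add: supp)
        have "q * \<bar>w $ i $ j\<bar> \<le> p $ i $ j * \<bar>w $ i $ j\<bar>"
          using q(2)[OF P] by (intro mult_right_mono) auto
        then show ?thesis using exp_linear_coercive[OF B P, of "w $ i $ j"] by linarith
      qed
    qed
    finally show ?thesis by (simp add: \<Psi>_def K_def sum.distrib)
  qed
  \<comment> \<open>The range is a subspace of finite dimension, hence closed. By
    \<open>bound\<close>, the ball contains every point of it where \<Psi> is at most its value at
    0, so minimising over the compact set \<open>S\<close> suffices.\<close>
  define S where "S = range (edge_sum B) \<inter> cball 0 ((\<Psi> 0 + K) / q)"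
  have "subspace (range (edge_sum B))"
    using linear_subspace_image[OF linear_edge_sum subspace_UNIV] .
  then have "compact S" "0 \<in> range (edge_sum B)"
    unfolding S_def by (auto intro!: closed_Int_compact closed_subspace subspace_0)
  moreover from this have "0 \<in> S"
    using bound[of 0] q(1) by (simp add: S_def)
  moreover have "continuous_on S \<Psi>"
    unfolding \<Psi>_def by (intro continuous_intros)
  ultimately obtain w where w: "w \<in> S" "\<And>w'. w' \<in> S \<Longrightarrow> \<Psi> w \<le> \<Psi> w'"
    using continuous_attains_inf[of S \<Psi>] by blast
  then obtain u v where uv: "w = edge_sum B (u, v)" by (auto simp: S_def)
  show ?thesis
  proof
    fix u' v'
    let ?w = "edge_sum B (u', v')"
    have "\<Psi> w \<le> \<Psi> ?w"
    proof (cases "\<Psi> ?w \<le> \<Psi> 0")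
      case True
      then have "q * norm ?w \<le> \<Psi> 0 + K" using bound[of ?w] by simp
      then have "?w \<in> S" using q(1) by (simp add: S_def field_simps)
      then show ?thesis by (rule w(2))
    next
      case False
      then show ?thesis using w(2)[OF \<open>0 \<in> S\<close>] by simp
    qed
    then show "potential B u v \<le> potential B u' v'" by (simp add: uv \<Psi>)
  qed
qed

text \<open>The inverses of the witnessing permutations serve the transpose; statements on columns
  can then be read off from those on rows.\<close>

lemma total_support_transpose:
  assumes "total_support B"
  shows "total_support (transpose B)"
proof -
  have "\<exists>\<sigma>. \<sigma> permutes UNIV \<and> \<sigma> i = j \<and> (\<forall>l. 0 < B $ \<sigma> l $ l)" if "0 < B $ j $ i" for i j
  proof -
    have "\<exists>\<sigma>. \<sigma> permutes UNIV \<and> \<sigma> j = i \<and> (\<forall>l. 0 < B $ l $ \<sigma> l)"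
      using assms that by (simp add: total_support_def)
    then obtain \<sigma> where \<sigma>: "\<sigma> permutes UNIV" "\<sigma> j = i" "\<And>l. 0 < B $ l $ \<sigma> l"
      by blast
    have "0 < B $ inv \<sigma> l $ l" for l
      using \<sigma>(3)[of "inv \<sigma> l"] permutes_inverses(1)[OF \<sigma>(1)] by simp
    moreover have "inv \<sigma> i = j" using \<sigma>(2) permutes_inverses(2)[OF \<sigma>(1)] by auto
    ultimately show ?thesis using permutes_inv[OF \<sigma>(1)] by blast
  qed
  moreover have "transpose B \<noteq> 0"
    using assms by (auto simp: total_support_def transpose_def vec_eq_iff)
  ultimately show ?thesis using assms by (auto simp: total_support_def transpose_def)
qed

lemma total_support_row_sum_pos:
  assumes "total_support B"
  shows "0 < row_sum B u v i"
proof -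
  obtain p where p: "doubly_stochastic p" "\<And>i j. 0 < p $ i $ j \<longleftrightarrow> 0 < B $ i $ j"
    using total_support_doubly_stochastic[OF assms] by blast
  have "(\<Sum>j\<in>UNIV. p $ i $ j) \<noteq> 0" using p(1) by (simp add: doubly_stochastic_def)
  then obtain j where "p $ i $ j \<noteq> 0" by (meson sum.neutral)
  then have "0 < B $ i $ j" using p by (metis doubly_stochastic_def order_less_le)
  then show ?thesis
    using assms by (intro row_sum_pos[of B i j]) (simp_all add: total_support_def)
qed

text \<open>A joint minimiser is minimal in \<open>u\<close> alone and in \<open>v\<close> alone;
  the former normalises the rows and the latter, by transposition, the columns.\<close>

lemma total_support_ex_scaling:
  assumes "total_support B"
  obtains u v where "\<And>i. row_sum B u v i = 1" "\<And>j. row_sum (transpose B) v u j = 1"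
proof -
  obtain u v where min: "\<And>u' v'. potential B u v \<le> potential B u' v'"
    using total_support_ex_minimizer[OF assms] by blast
  show ?thesis
  proof
    show "row_sum B u v i = 1" for i
      by (intro row_sum_eq_1_if_minimal total_support_row_sum_pos assms min)
    show "row_sum (transpose B) v u j = 1" for j
      by (intro row_sum_eq_1_if_minimal total_support_row_sum_pos total_support_transpose assms)
        (simp add: potential_transpose min)
  qed
qed

section \<open>The excess over the minimum at a doubly stochastic matrix\<close>

lemma doubly_stochastic_row_sum_pos:
  assumes "doubly_stochastic P"
  shows "0 < row_sum P u v i"
proof -
  have "(\<Sum>j\<in>UNIV. P $ i $ j) \<noteq> 0" using assms by (simp add: doubly_stochastic_def)
  then obtain j where "P $ i $ j \<noteq> 0" by (meson sum.neutral)
  then show ?thesis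
    using assms by (intro row_sum_pos[of P i j]) (auto simp: doubly_stochastic_def order_less_le)
qed

text \<open>A row sum is the average of \<open>exp (u $ i + v $ j)\<close> with the weights
  \<open>P $ i $ j\<close>, whose total is 1.\<close>

lemma doubly_stochastic_row_sum_bounds:
  assumes ds: "doubly_stochastic P" and M: "\<And>i j. 0 < P $ i $ j \<Longrightarrow> \<bar>u $ i + v $ j\<bar> \<le> M"
  shows "exp (- M) \<le> row_sum P u v i" "row_sum P u v i \<le> exp M"
proof -
  have one: "(\<Sum>j\<in>UNIV. P $ i $ j * b) = b" for b
    using ds by (simp add: doubly_stochastic_def flip: sum_distrib_right)
  have nonneg: "0 \<le> P $ i $ j" for j using ds by (simp add: doubly_stochastic_def)
  have le: "P $ i $ j * exp (- M) \<le> P $ i $ j * exp (u $ i + v $ j)"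
    "P $ i $ j * exp (u $ i + v $ j) \<le> P $ i $ j * exp M" for j
    using M[of i j] nonneg[of j] by (cases "P $ i $ j = 0"; force simp: abs_le_iff)+
  show "exp (- M) \<le> row_sum P u v i"
    unfolding row_sum_def by (subst one[symmetric]) (intro sum_mono le)
  show "row_sum P u v i \<le> exp M"
    unfolding row_sum_def by (subst (2) one[symmetric]) (intro sum_mono le)
qed

definition excess :: "real^'n^'n \<Rightarrow> real^'n \<Rightarrow> real^'n \<Rightarrow> real" where
  "excess P u v = (\<Sum>i\<in>UNIV. \<Sum>j\<in>UNIV. P $ i $ j * (exp (u $ i + v $ j) - 1 - (u $ i + v $ j)))"

text \<open>The constant is the total mass of \<open>P\<close>. The two functions therefore decrease
  by equal amounts under updates.\<close>

lemma excess_eq_potential: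
  assumes "doubly_stochastic (P :: real^'n^'n)"
  shows "excess P u v = potential P u v - real CARD('n)"
proof -
  have "(\<Sum>i\<in>UNIV. \<Sum>j\<in>UNIV. P $ i $ j) = real CARD('n)"
    using assms by (simp add: doubly_stochastic_def)
  moreover have "excess P u v = (\<Sum>i\<in>UNIV. \<Sum>j\<in>UNIV. P $ i $ j * exp (u $ i + v $ j)
      - P $ i $ j - P $ i $ j * (u $ i + v $ j))"
    unfolding excess_def by (simp add: algebra_simps)
  ultimately show ?thesis
    by (simp add: sum_subtractf doubly_stochastic_sum[OF assms] potential_def row_sum_def)
qed

lemma excess_term_nonneg:
  "doubly_stochastic P \<Longrightarrow> 0 \<le> P $ i $ j * (exp (u $ i + v $ j) - 1 - (u $ i + v $ j))"
  by (intro mult_nonneg_nonneg exp_minus_one_minus_nonneg) (simp add: doubly_stochastic_def)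

lemma excess_nonneg: "doubly_stochastic P \<Longrightarrow> 0 \<le> excess P u v"
  unfolding excess_def by (intro sum_nonneg excess_term_nonneg)

lemma excess_term_le:
  assumes "doubly_stochastic P"
  shows "P $ i $ j * (exp (u $ i + v $ j) - 1 - (u $ i + v $ j)) \<le> excess P u v"
proof -
  have "P $ i $ j * (exp (u $ i + v $ j) - 1 - (u $ i + v $ j))
      \<le> (\<Sum>j\<in>UNIV. P $ i $ j * (exp (u $ i + v $ j) - 1 - (u $ i + v $ j)))"
    by (intro member_le_sum excess_term_nonneg assms) auto
  also have "\<dots> \<le> excess P u v"
    unfolding excess_def
    by (intro member_le_sum[where f = "\<lambda>i. \<Sum>j\<in>UNIV. P $ i $ j * (exp (u $ i + v $ j) - 1 - (u $ i + v $ j))"]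
        sum_nonneg excess_term_nonneg assms) auto
  finally show ?thesis .
qed

text \<open>A single summand is at most the whole excess, and the positive weights are bounded
  below, so \<open>exp z - 1 - z\<close> is bounded on every edge.\<close>

lemma excess_sublevel_bounded:
  assumes ds: "doubly_stochastic P"
  obtains M where "\<And>u v i j. excess P u v \<le> K \<Longrightarrow> 0 < P $ i $ j \<Longrightarrow> \<bar>u $ i + v $ j\<bar> \<le> M"
proof -
  obtain q where q: "0 < q" "\<And>i j. 0 < P $ i $ j \<Longrightarrow> q \<le> P $ i $ j"
    using ex_pos_lower_bound[of P] by blast
  have "\<bar>u $ i + v $ j\<bar> \<le> K / q + 1" if K: "excess P u v \<le> K" and P: "0 < P $ i $ j" for u v i j
  proof -
    let ?z = "u $ i + v $ j"
    have "q * (exp ?z - 1 - ?z) \<le> P $ i $ j * (exp ?z - 1 - ?z)"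
      by (intro mult_right_mono exp_minus_one_minus_nonneg q(2) P)
    also have "\<dots> \<le> K" using excess_term_le[OF ds, of i j u v] K by linarith
    finally have "exp ?z - 1 - ?z \<le> K / q" using q(1) by (simp add: field_simps)
    then show ?thesis using abs_le_exp_minus[of ?z] by linarith
  qed
  then show ?thesis using that by blast
qed

text \<open>Convexity, tested along the segment to the minimiser \<open>(0, 0)\<close>.\<close>

lemma excess_le_gradient:
  "doubly_stochastic P \<Longrightarrow> excess P u v \<le> (\<Sum>i\<in>UNIV. u $ i * (row_sum P u v i - 1))
     + (\<Sum>j\<in>UNIV. v $ j * (row_sum (transpose P) v u j - 1))"
proof -
  assume ds: "doubly_stochastic P"
  let ?e = "\<lambda>i j. P $ i $ j * (exp (u $ i + v $ j) - 1)"
  have rows: "row_sum P u v i - 1 = (\<Sum>j\<in>UNIV. ?e i j)" for i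
    using ds by (simp add: row_sum_def doubly_stochastic_def right_diff_distrib sum_subtractf)
  have cols: "row_sum (transpose P) v u j - 1 = (\<Sum>i\<in>UNIV. ?e i j)" for j
    using ds by (simp add: row_sum_transpose doubly_stochastic_def right_diff_distrib sum_subtractf)
  have "excess P u v \<le> (\<Sum>i\<in>UNIV. \<Sum>j\<in>UNIV. P $ i $ j * ((exp (u $ i + v $ j) - 1) * (u $ i + v $ j)))"
    unfolding excess_def using ds
    by (intro sum_mono mult_left_mono exp_minus_one_minus_le) (simp add: doubly_stochastic_def)
  also have "\<dots> = (\<Sum>i\<in>UNIV. \<Sum>j\<in>UNIV. u $ i * ?e i j) + (\<Sum>i\<in>UNIV. \<Sum>j\<in>UNIV. v $ j * ?e i j)"
    by (simp add: algebra_simps flip: sum.distrib)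
  also have "(\<Sum>i\<in>UNIV. \<Sum>j\<in>UNIV. v $ j * ?e i j) = (\<Sum>j\<in>UNIV. \<Sum>i\<in>UNIV. v $ j * ?e i j)"
    by (rule sum.swap)
  finally show ?thesis by (simp add: rows cols sum_distrib_left)
qed

text \<open>The Lojasiewicz inequality for the excess. The right inverse of \<^const>\<open>edge_sum\<close> picks
  among all \<open>(u, v)\<close> with the same edge sums a representative controlled by these sums.\<close>

lemma excess_le_gradient_square:
  assumes ds: "doubly_stochastic P"
  obtains c where "0 < c" "\<And>u v. (\<And>i j. 0 < P $ i $ j \<Longrightarrow> \<bar>u $ i + v $ j\<bar> \<le> M) \<Longrightarrow>
    excess P u v \<le> c * ((\<Sum>i\<in>UNIV. (row_sum P u v i - 1)\<^sup>2)
                        + (\<Sum>j\<in>UNIV. (row_sum (transpose P) v u j - 1)\<^sup>2))"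
proof -
  obtain G where G: "linear G" "\<And>x. edge_sum P (G (edge_sum P x)) = edge_sum P x"
    using linear_exists_right_inverse_on[OF linear_edge_sum subspace_UNIV, of P] by auto
  obtain b where b: "0 < b" "\<And>w. norm (G w) \<le> b * norm w"
    using linear_bounded_pos[OF G(1)] by blast
  obtain q where q: "0 < q" "\<And>i j. 0 < P $ i $ j \<Longrightarrow> q \<le> P $ i $ j"
    using ex_pos_lower_bound[of P] by blast
  \<comment> \<open>Least positive weight times the strong convexity constant of
    \<open>exp z - 1 - z\<close> on the interval from \<open>- M\<close> to
    \<open>M\<close>.\<close>
  define a where "a = q * (exp (- M) / 2)"
  have a: "0 < a" using q(1) by (simp add: a_def)
  show ?thesis
  proof
    show "0 < b\<^sup>2 / a" using a b(1) by simp
    fix u v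
    assume M: "\<And>i j. 0 < P $ i $ j \<Longrightarrow> \<bar>u $ i + v $ j\<bar> \<le> M"
    define w where "w = edge_sum P (u, v)"
    define x where "x = G w"
    \<comment> \<open>The gradient of the potential at \<open>(u, v)\<close>.\<close>
    define g :: "(real^'a) \<times> (real^'a)"
      where "g = (\<chi> i. row_sum P u v i - 1, \<chi> j. row_sum (transpose P) v u j - 1)"
    have nonneg: "0 \<le> P $ i $ j" for i j using ds by (simp add: doubly_stochastic_def)
    have "edge_sum P x = edge_sum P (u, v)" by (simp add: x_def w_def G(2))
    \<comment> \<open>Row sums, column sums and excess see \<open>(u, v)\<close> only through the
      sums on the support, so \<open>x\<close> may replace \<open>(u, v)\<close> in all of
      them.\<close>
    then have edge: "fst x $ i + snd x $ j = u $ i + v $ j" if "P $ i $ j \<noteq> 0" for i j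
      using that unfolding edge_sum_def vec_eq_iff by (simp split: if_splits) metis
    have rows: "row_sum P (fst x) (snd x) i = row_sum P u v i" for i
      unfolding row_sum_def by (intro sum.cong refl) (metis edge mult_zero_left)
    have cols: "row_sum (transpose P) (snd x) (fst x) j = row_sum (transpose P) v u j" for j
      unfolding row_sum_transpose by (intro sum.cong refl) (metis edge mult_zero_left)
    have ex: "excess P (fst x) (snd x) = excess P u v"
      unfolding excess_def by (intro sum.cong refl) (metis edge mult_zero_left)
    have "excess P u v \<le> x \<bullet> g"
      using excess_le_gradient[OF ds, of "fst x" "snd x"]
      by (simp add: rows cols ex inner_prod_def inner_vec_def g_def)
    also have "\<dots> \<le> norm x * norm g" by (rule norm_cauchy_schwarz)
    finally have le: "excess P u v \<le> norm x * norm g" .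
    have "a * (norm w)\<^sup>2 = (\<Sum>i\<in>UNIV. \<Sum>j\<in>UNIV. a * (w $ i $ j)\<^sup>2)"
      by (simp add: norm_matrix_square sum_distrib_left)
    also have "\<dots> \<le> excess P u v"
      unfolding excess_def
    proof (intro sum_mono)
      fix i j
      show "a * (w $ i $ j)\<^sup>2 \<le> P $ i $ j * (exp (u $ i + v $ j) - 1 - (u $ i + v $ j))"
      proof (cases "P $ i $ j = 0")
        case True
        then show ?thesis by (simp add: w_def edge_sum_def)
      next
        case False
        then have P: "0 < P $ i $ j" using nonneg[of i j] by simp
        show ?thesis
          using mult_mono[OF q(2)[OF P] exp_ge_one_plus_square[OF M[OF P]]] P False
          by (simp add: w_def edge_sum_def a_def mult.assoc)
      qed
    qed
    finally have w: "a * (norm w)\<^sup>2 \<le> excess P u v" .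
    have "(norm x)\<^sup>2 \<le> (b * norm w)\<^sup>2" unfolding x_def by (intro power_mono b(2)) simp
    also have "\<dots> \<le> b\<^sup>2 / a * excess P u v"
      using mult_left_mono[OF w, of "b\<^sup>2 / a"] a by (simp add: power_mult_distrib)
    finally have x: "(norm x)\<^sup>2 \<le> b\<^sup>2 / a * excess P u v" .
    \<comment> \<open>Squaring the Cauchy-Schwarz bound and inserting the bound on
      \<open>norm x\<close> leaves the excess as a factor on both sides, which is then
      cancelled.\<close>
    have "(excess P u v)\<^sup>2 \<le> (norm x)\<^sup>2 * (norm g)\<^sup>2"
      using power_mono[OF le excess_nonneg[OF ds], of 2] by (simp add: power_mult_distrib)
    also have "\<dots> \<le> b\<^sup>2 / a * excess P u v * (norm g)\<^sup>2" by (intro mult_right_mono x) simp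
    finally have "excess P u v * excess P u v \<le> excess P u v * (b\<^sup>2 / a * (norm g)\<^sup>2)"
      by (simp add: power2_eq_square ac_simps)
    then have "excess P u v \<le> b\<^sup>2 / a * (norm g)\<^sup>2"
    proof (cases "excess P u v = 0")
      case False
      then have "0 < excess P u v" using excess_nonneg[OF ds, of u v] by simp
      with \<open>excess P u v * excess P u v \<le> _\<close> show ?thesis
        by (rule mult_left_le_imp_le)
    qed (use a in simp)
    also have "(norm g)\<^sup>2 = (\<Sum>i\<in>UNIV. (row_sum P u v i - 1)\<^sup>2)
                        + (\<Sum>j\<in>UNIV. (row_sum (transpose P) v u j - 1)\<^sup>2)"
      by (simp add: g_def norm_prod_def norm_vec_def L2_set_def sum_nonneg)
    finally show "excess P u v \<le> b\<^sup>2 / a * ((\<Sum>i\<in>UNIV. (row_sum P u v i - 1)\<^sup>2)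
                        + (\<Sum>j\<in>UNIV. (row_sum (transpose P) v u j - 1)\<^sup>2))" .
  qed
qed

section \<open>Geometric decay of the excess\<close>

lemma ln_gap_ge_square:
  fixes s :: real
  assumes "exp (- M) \<le> s" "s \<le> exp M"
  shows "exp (- M) / (2 * (exp M)\<^sup>2) * (s - 1)\<^sup>2 \<le> s - 1 - ln s"
proof -
  have s: "0 < s" using assms(1) exp_gt_zero[of "- M"] by linarith
  then have M: "\<bar>ln s\<bar> \<le> M"
    using assms ln_ge_iff[OF s, of "- M"] ln_le_cancel_iff[OF s, of "exp M"] by simp
  \<comment> \<open>With \<open>t = ln s\<close> the gap is \<open>exp t - 1 - t\<close>, bounded
    below by a multiple of the square of \<open>t\<close>, while \<open>s - 1\<close> is at most
    \<open>exp M\<close> times \<open>t\<close> in absolute value.\<close>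
  have "(s - 1)\<^sup>2 \<le> (exp M * \<bar>ln s\<bar>)\<^sup>2"
    using power_mono[OF abs_exp_minus_one_le[OF M], of 2] s by simp
  then have "exp (- M) / (2 * (exp M)\<^sup>2) * (s - 1)\<^sup>2
      \<le> exp (- M) / (2 * (exp M)\<^sup>2) * (exp M * \<bar>ln s\<bar>)\<^sup>2"
    by (intro mult_left_mono) auto
  also have "\<dots> = exp (- M) / 2 * (ln s)\<^sup>2" by (simp add: power_mult_distrib)
  also have "\<dots> \<le> s - 1 - ln s" using exp_ge_one_plus_square[OF M] s by simp
  finally show ?thesis .
qed

text \<open>With unit row sums the gradient has only its column part. The column update gains at
  least \<open>a\<close> times the squared norm of that part, and the Lojasiewicz inequality bounds
  the excess by \<open>c\<close> times the same quantity.\<close>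

lemma excess_col_update_contraction:
  assumes ds: "doubly_stochastic P"
  obtains \<rho> where "0 < \<rho>" "\<rho> < 1"
    "\<And>u v. excess P u v \<le> K \<Longrightarrow> (\<And>i. row_sum P u v i = 1) \<Longrightarrow>
       excess P u (row_update (transpose P) v u) \<le> \<rho> * excess P u v"
proof -
  obtain M where M: "\<And>u v i j. excess P u v \<le> K \<Longrightarrow> 0 < P $ i $ j \<Longrightarrow> \<bar>u $ i + v $ j\<bar> \<le> M"
    using excess_sublevel_bounded[OF ds, of K] by blast
  obtain c where c: "0 < c" "\<And>u v. (\<And>i j. 0 < P $ i $ j \<Longrightarrow> \<bar>u $ i + v $ j\<bar> \<le> M) \<Longrightarrow>
    excess P u v \<le> c * ((\<Sum>i\<in>UNIV. (row_sum P u v i - 1)\<^sup>2)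
                        + (\<Sum>j\<in>UNIV. (row_sum (transpose P) v u j - 1)\<^sup>2))"
    using excess_le_gradient_square[OF ds, of M] by blast
  define a where "a = exp (- M) / (2 * (exp M)\<^sup>2)"
  have a: "0 < a" by (simp add: a_def)
  have ds': "doubly_stochastic (transpose P)" by (rule doubly_stochastic_transpose[OF ds])
  show ?thesis
  proof
    \<comment> \<open>The minimum with 1/2 keeps the rate positive even if \<open>a / c\<close> is
      at least 1.\<close>
    show "0 < 1 - min (a / c) (1 / 2)" by (simp add: min_less_iff_disj)
    show "1 - min (a / c) (1 / 2) < 1" using a c(1) by simp
    fix u v
    assume K: "excess P u v \<le> K" and rows: "\<And>i. row_sum P u v i = 1"
    let ?s = "row_sum (transpose P) v u"
    have M': "\<bar>v $ j + u $ i\<bar> \<le> M" if "0 < transpose P $ j $ i" for i j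
      using M[OF K, of i j] that by (simp add: transpose_def add.commute)
    have bounds: "exp (- M) \<le> ?s j" "?s j \<le> exp M" for j
      using doubly_stochastic_row_sum_bounds[OF ds' M'] by blast+
    have "excess P u v \<le> c * (\<Sum>j\<in>UNIV. (?s j - 1)\<^sup>2)"
      using c(2)[OF M[OF K]] by (simp add: rows)
    then have "a / c * excess P u v \<le> (\<Sum>j\<in>UNIV. a * (?s j - 1)\<^sup>2)"
      using a c(1) mult_left_mono[of "excess P u v" "c * (\<Sum>j\<in>UNIV. (?s j - 1)\<^sup>2)" "a / c"]
      by (simp add: sum_distrib_left)
    also have "\<dots> \<le> (\<Sum>j\<in>UNIV. ?s j - 1 - ln (?s j))"
      unfolding a_def by (intro sum_mono ln_gap_ge_square bounds)
    also have "\<dots> = excess P u v - excess P u (row_update (transpose P) v u)"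
      using potential_row_update[OF doubly_stochastic_row_sum_pos[OF ds'], of v u]
      by (simp add: excess_eq_potential[OF ds] potential_transpose)
    finally have "a / c * excess P u v \<le> excess P u v - excess P u (row_update (transpose P) v u)" .
    moreover have "min (a / c) (1 / 2) * excess P u v \<le> a / c * excess P u v"
      by (intro mult_right_mono excess_nonneg ds) auto
    ultimately show "excess P u (row_update (transpose P) v u)
        \<le> (1 - min (a / c) (1 / 2)) * excess P u v"
      by (simp add: left_diff_distrib)
  qed
qed

text \<open>The column step contracts and the row step does not increase the excess. Counting starts
  at index 1, as unit row sums hold only after a row update; one rate serves all steps because the
  excess stays below its value there.\<close>

lemma alternating_updates_excess:
  fixes u v :: "nat \<Rightarrow> real^'n"
  assumes ds: "doubly_stochastic P"
    and v: "\<And>k. v (Suc k) = row_update (transpose P) (v k) (u k)"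
    and u: "\<And>k. u (Suc k) = row_update P (u k) (v (Suc k))"
  obtains \<rho> where "0 < \<rho>" "\<rho> < 1"
    "\<And>k. excess P (u (Suc k)) (v (Suc k)) \<le> excess P (u 1) (v 1) * \<rho> ^ k"
proof -
  define f where "f k = excess P (u (Suc k)) (v (Suc k))" for k
  obtain \<rho> where \<rho>: "0 < \<rho>" "\<rho> < 1"
    "\<And>u' v'. excess P u' v' \<le> f 0 \<Longrightarrow> (\<And>i. row_sum P u' v' i = 1) \<Longrightarrow>
       excess P u' (row_update (transpose P) v' u') \<le> \<rho> * excess P u' v'"
    using excess_col_update_contraction[OF ds, of "f 0"] by blast
  have rows: "row_sum P (u (Suc k)) (v (Suc k)) i = 1" for k i
    unfolding u by (intro row_sum_row_update doubly_stochastic_row_sum_pos ds)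
  have mono: "f (Suc k) \<le> excess P (u (Suc k)) (v (Suc (Suc k)))" for k
    using potential_row_update_le[OF doubly_stochastic_row_sum_pos[OF ds]]
    unfolding f_def u[of "Suc k"] by (simp add: excess_eq_potential[OF ds])
  have step: "f (Suc k) \<le> \<rho> * f k" if "f k \<le> f 0" for k
  proof -
    note mono[of k]
    also have "excess P (u (Suc k)) (v (Suc (Suc k))) \<le> \<rho> * f k"
      unfolding f_def v[of "Suc k"] by (rule \<rho>(3)[OF that[unfolded f_def[of k]] rows])
    finally show ?thesis .
  qed
  have "f k \<le> f 0 * \<rho> ^ k" for k
  proof (induction k)
    case (Suc k)
    have "f 0 * \<rho> ^ k \<le> f 0 * 1"
      using \<rho>(1,2) by (intro mult_left_mono power_le_one) (auto simp: f_def excess_nonneg ds)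
    then have "f (Suc k) \<le> \<rho> * f k" using Suc step by simp
    also have "\<dots> \<le> \<rho> * (f 0 * \<rho> ^ k)" using Suc \<rho>(1) by (intro mult_left_mono) auto
    finally show ?case by (simp add: ac_simps)
  qed simp
  with \<rho>(1,2) show ?thesis by (intro that) (auto simp: f_def)
qed

section \<open>From scaling exponents back to the matrix iteration\<close>

definition rescale :: "real^'n^'n \<Rightarrow> real^'n \<Rightarrow> real^'n \<Rightarrow> real^'n^'n" where
  "rescale R u v = (\<chi> i j. R $ i $ j * exp ((u $ i + v $ j) / 2))"

lemma exp_half_square: "(exp (z / 2))\<^sup>2 = exp (z :: real)"
  by (simp add: power2_eq_square flip: exp_add)

lemma transpose_rescale: "transpose (rescale R u v) = rescale (transpose R) v u"
  by (simp add: rescale_def transpose_def vec_eq_iff add.commute)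

lemma transpose_hadamard: "transpose (hadamard A B) = hadamard (transpose A) (transpose B)"
  by (simp add: hadamard_def transpose_def vec_eq_iff)

text \<open>The reason for the factor 1/2 in \<open>rescale\<close>: the squared entries are those
  of \<open>hadamard R R\<close> multiplied by \<open>exp (u $ i + v $ j)\<close>.\<close>

lemma norm_row_rescale:
  "norm (row i (rescale R u v)) = sqrt (row_sum (hadamard R R) u v i)"
  by (simp add: norm_vec_def L2_set_def row_def rescale_def row_sum_def hadamard_def
      power_mult_distrib exp_half_square power2_eq_square[of "R $ _ $ _"])

lemma norm_column_rescale:
  "norm (column j (rescale R u v)) = sqrt (row_sum (transpose (hadamard R R)) v u j)"
  unfolding transpose_hadamard norm_row_rescale[symmetric] transpose_rescale[symmetric] row_transpose ..

lemma normalize_rows_rescale: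
  assumes "\<And>i. 0 < row_sum (hadamard R R) u v i"
  shows "normalize_rows (rescale R u v) = rescale R (row_update (hadamard R R) u v) v"
proof -
  have "exp (ln (row_sum (hadamard R R) u v i) / 2) = sqrt (row_sum (hadamard R R) u v i)" for i
    using assms[of i] by (simp add: exp_half_square real_sqrt_unique[symmetric])
  then show ?thesis
    by (simp add: vec_eq_iff normalize_rows_def Diag_mult_component recip_row_norms_def
        norm_row_rescale)
      (simp add: rescale_def row_update_def exp_diff add_divide_distrib diff_divide_distrib exp_add)
qed

lemma normalize_cols_transpose: "normalize_cols M = transpose (normalize_rows (transpose M))"
  by (simp add: vec_eq_iff normalize_cols_def normalize_rows_def transpose_def
      mult_Diag_component Diag_mult_component recip_col_norms_def recip_row_norms_def
      row_def column_def)

lemma normalize_cols_rescale: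
  assumes "\<And>j. 0 < row_sum (transpose (hadamard R R)) v u j"
  shows "normalize_cols (rescale R u v) = rescale R u (row_update (transpose (hadamard R R)) v u)"
  using normalize_rows_rescale[of "transpose R" v u] assms
  by (simp add: normalize_cols_transpose transpose_rescale transpose_hadamard)

lemma norm_rescale_diff_square:
  "(norm (rescale R u v - R))\<^sup>2 \<le> excess (hadamard R R) u v"
  unfolding norm_matrix_square excess_def
proof (intro sum_mono)
  fix i j
  have "((rescale R u v - R) $ i $ j)\<^sup>2 = (R $ i $ j)\<^sup>2 * (exp ((u $ i + v $ j) / 2) - 1)\<^sup>2"
    by (simp add: rescale_def algebra_simps flip: power_mult_distrib)
  also have "\<dots> \<le> (R $ i $ j)\<^sup>2 * (exp (u $ i + v $ j) - 1 - (u $ i + v $ j))"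
    by (intro mult_left_mono exp_half_minus_one_square_le) simp
  finally show "((rescale R u v - R) $ i $ j)\<^sup>2
      \<le> hadamard R R $ i $ j * (exp (u $ i + v $ j) - 1 - (u $ i + v $ j))"
    by (simp add: hadamard_def power2_eq_square)
qed

text \<open>The rate becomes the square root \<open>r\<close> of \<rho>. Dividing by
  \<open>r\<close> makes up for the index shift, and \<gamma> also absorbs the initial term.\<close>

lemma converges_linearly_if_square_bound:
  assumes "0 < \<rho>" "\<rho> < 1" and bound: "\<And>k. (norm (X (Suc k) - L))\<^sup>2 \<le> a * \<rho> ^ k"
  shows "converges_linearly X L"
proof -
  define r where "r = sqrt \<rho>"
  have r: "0 < r" "r < 1" using assms by (auto simp: r_def)
  have a: "0 \<le> a" using bound[of 0] by (auto intro: order_trans[OF zero_le_power2])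
  define \<gamma> where "\<gamma> = norm (X 0 - L) + sqrt a / r + 1"
  have \<gamma>: "0 < \<gamma>" "norm (X 0 - L) \<le> \<gamma>" "sqrt a / r \<le> \<gamma>"
    using a r by (auto simp: \<gamma>_def add_nonneg_pos)
  have "norm (X k - L) \<le> \<gamma> * r ^ k" for k
  proof (cases k)
    case 0
    then show ?thesis using \<gamma>(2) by simp
  next
    case (Suc l)
    have "norm (X k - L) \<le> sqrt (a * \<rho> ^ l)" using bound[of l] Suc by (intro real_le_rsqrt) simp
    also have "\<dots> = sqrt a / r * r ^ k"
      using r Suc by (simp add: real_sqrt_mult real_sqrt_power r_def)
    also have "\<dots> \<le> \<gamma> * r ^ k" using \<gamma>(3) r by (intro mult_right_mono) auto
    finally show ?thesis .
  qed
  with \<gamma>(1) r show ?thesis unfolding converges_linearly_def by blast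
qed

text \<open>In terms of the exponents each normalisation is an update for
  \<open>hadamard R R\<close>, so the decay of the excess bounds the squared distance to
  \<open>R\<close>.\<close>

lemma sk_iter_rescale_converges:
  assumes ds: "doubly_stochastic (hadamard R R)"
  shows "converges_linearly (sk_iter (rescale R u\<^sub>0 v\<^sub>0)) R"
proof -
  define P where "P = hadamard R R"
  \<comment> \<open>Columns come first: the row update already uses the new
    \<open>v'\<close>.\<close>
  define next_uv where "next_uv = (\<lambda>(u, v). let v' = row_update (transpose P) v u in (row_update P u v', v'))"
  define uv where "uv k = (next_uv ^^ k) (u\<^sub>0, v\<^sub>0)" for k :: nat
  define u v where "u k = fst (uv k)" and "v k = snd (uv k)" for k
  have v: "v (Suc k) = row_update (transpose P) (v k) (u k)" for k
    by (simp add: u_def v_def uv_def next_uv_def Let_def case_prod_beta)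
  have u: "u (Suc k) = row_update P (u k) (v (Suc k))" for k
    by (simp add: u_def v_def uv_def next_uv_def Let_def case_prod_beta)
  note pos = doubly_stochastic_row_sum_pos[OF ds] 
    doubly_stochastic_row_sum_pos[OF doubly_stochastic_transpose[OF ds]]
  have iter: "sk_iter (rescale R u\<^sub>0 v\<^sub>0) k = rescale R (u k) (v k)" for k
  proof (induction k)
    case 0
    show ?case by (simp add: u_def v_def uv_def)
  next
    case (Suc k)
    then show ?case
      by (simp add: u v P_def normalize_cols_rescale normalize_rows_rescale pos)
  qed
  obtain \<rho> where \<rho>: "0 < \<rho>" "\<rho> < 1"
    "\<And>k. excess P (u (Suc k)) (v (Suc k)) \<le> excess P (u 1) (v 1) * \<rho> ^ k"
    using alternating_updates_excess[of P v u, OF ds[folded P_def] v u] by blast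
  show ?thesis
  proof (rule converges_linearly_if_square_bound[OF \<rho>(1,2)])
    show "(norm (sk_iter (rescale R u\<^sub>0 v\<^sub>0) (Suc k) - R))\<^sup>2 \<le> excess P (u 1) (v 1) * \<rho> ^ k" for k
      unfolding iter using norm_rescale_diff_square \<rho>(3)[of k] unfolding P_def
      by (meson order_trans)
  qed
qed

section \<open>The scaling condition as a necessary condition for minimal \<omega>\<close>

lemma diag_scaled_gram:
  "diag (Diag c ** A ** Diag d ** transpose A) $ i = c $ i * (\<Sum>j\<in>UNIV. (A $ i $ j)\<^sup>2 * d $ j)"
proof -
  have "diag (Diag c ** A ** Diag d ** transpose A) $ i
      = (\<Sum>j\<in>UNIV. (Diag c ** A ** Diag d) $ i $ j * A $ i $ j)"
    by (simp add: diag_def matrix_matrix_mult_def[of "Diag c ** A ** Diag d"] transpose_def)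
  also have "\<dots> = (\<Sum>j\<in>UNIV. c $ i * ((A $ i $ j)\<^sup>2 * d $ j))"
    by (simp add: mult_Diag_component Diag_mult_component power2_eq_square ac_simps)
  finally show ?thesis by (simp add: sum_distrib_left)
qed

lemma scaling_condition_Diag:
  assumes "0 < \<alpha>" "\<And>i. c $ i * (\<Sum>j\<in>UNIV. (A $ i $ j)\<^sup>2 * d $ j) = \<alpha>"
    "\<And>j. d $ j * (\<Sum>i\<in>UNIV. (A $ i $ j)\<^sup>2 * c $ i) = \<alpha>"
  shows "scaling_condition A (Diag c) (Diag d)"
proof -
  have "diag (Diag d ** transpose A ** Diag c ** A) $ j = \<alpha>" for j
    using diag_scaled_gram[of d "transpose A" c j] assms(3)[of j] by (simp add: transpose_def)
  then have "stack (diag (Diag c ** A ** Diag d ** transpose A))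
      (diag (Diag d ** transpose A ** Diag c ** A)) = \<alpha> *\<^sub>R (\<chi> k. 1)"
    using assms(2) by (auto simp: vec_eq_iff stack_def diag_scaled_gram split: sum.split)
  with assms(1) show ?thesis unfolding scaling_condition_def by blast
qed

text \<open>The total weight is the trace in \<^const>\<open>scaled_omega\<close>.\<close>

definition weight :: "real^'n^'n \<Rightarrow> real^'n \<Rightarrow> real^'n \<Rightarrow> real" where
  "weight A c d = (\<Sum>i\<in>UNIV. c $ i * (\<Sum>j\<in>UNIV. (A $ i $ j)\<^sup>2 * d $ j))"

lemma weight_transpose: "weight (transpose A) d c = weight A c d"
  unfolding weight_def by (simp add: sum_distrib_left, subst sum.swap) (simp add: transpose_def ac_simps)

lemma det_Diag: "det (Diag c) = (\<Prod>i\<in>UNIV. c $ i)"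
  by (subst det_diagonal) (auto simp: Diag_def)

lemma diag_sqrt_Diag: "diag_sqrt (Diag c) = Diag (\<chi> i. sqrt (c $ i))"
  by (simp add: diag_sqrt_def Diag_def)

lemma scaled_omega_eq:
  fixes A :: "real^'n^'n"
  assumes "pos_vec c" "pos_vec d"
  shows "scaled_omega A c d = weight A c d
     / ((det A)\<^sup>2 * (\<Prod>j\<in>UNIV. d $ j) * (\<Prod>i\<in>UNIV. c $ i)) powr (1 / real CARD('n)) / real CARD('n)"
proof -
  define M where "M = diag_sqrt (Diag c) ** A ** diag_sqrt (Diag d)"
  have nonneg: "0 \<le> c $ i" "0 \<le> d $ i" for i
    using assms by (auto simp: pos_vec_def less_imp_le)
  have M: "M $ i $ j = sqrt (c $ i) * A $ i $ j * sqrt (d $ j)" for i j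
    by (simp add: M_def diag_sqrt_Diag mult_Diag_component Diag_mult_component)
  have "trace (transpose M ** M) = (\<Sum>j\<in>UNIV. \<Sum>i\<in>UNIV. (M $ i $ j)\<^sup>2)"
    by (simp add: trace_def matrix_matrix_mult_def transpose_def power2_eq_square)
  also have "\<dots> = (\<Sum>i\<in>UNIV. \<Sum>j\<in>UNIV. (M $ i $ j)\<^sup>2)" by (rule sum.swap)
  also have "\<dots> = weight A c d"
    by (simp add: M weight_def sum_distrib_left power_mult_distrib nonneg ac_simps)
  finally have tr: "trace (transpose M ** M) = weight A c d" .
  have "det M = (\<Prod>i\<in>UNIV. sqrt (c $ i)) * det A * (\<Prod>j\<in>UNIV. sqrt (d $ j))"
    by (simp add: M_def diag_sqrt_Diag det_mul det_Diag)
  then have "(det M)\<^sup>2 = (\<Prod>i\<in>UNIV. c $ i) * (det A)\<^sup>2 * (\<Prod>j\<in>UNIV. d $ j)"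
    by (simp add: power_mult_distrib nonneg prod_power_distrib)
  then have "det (transpose M ** M) = (det A)\<^sup>2 * (\<Prod>j\<in>UNIV. d $ j) * (\<Prod>i\<in>UNIV. c $ i)"
    by (simp add: det_mul power2_eq_square ac_simps)
  with tr show ?thesis by (simp add: scaled_omega_def Let_def omega_def mult.commute flip: M_def)
qed

text \<open>Both sides vanish at \<open>s = 0\<close>, so their difference has a minimum there and
  its derivative \<open>b - a\<close> is 0.\<close>

lemma eq_if_linear_le_exp:
  fixes a b :: real
  assumes "\<And>s. a * s \<le> b * (exp s - 1)"
  shows "a = b"
proof -
  have "((\<lambda>s. b * (exp s - 1) - a * s) has_real_derivative b - a) (at 0)"
    by (auto intro!: derivative_eq_intros)
  then have "b - a = 0"
    by (rule DERIV_local_min[of _ _ _ 1]) (use assms in auto)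
  then show ?thesis by simp
qed

text \<open>Multiplying one \<open>c $ i\<close> by \<open>exp s\<close> turns minimality into an inequality in \<open>s\<close>.\<close>

lemma minimizer_row_sums:
  fixes A :: "real^'n^'n" and n :: real
  defines "n \<equiv> real CARD('n)"
  assumes c: "pos_vec c" and d: "pos_vec d" and \<kappa>: "0 < \<kappa>"
    and min: "\<And>c'. pos_vec c' \<Longrightarrow> weight A c d / (\<kappa> * (\<Prod>i\<in>UNIV. c $ i)) powr (1 / n)
       \<le> weight A c' d / (\<kappa> * (\<Prod>i\<in>UNIV. c' $ i)) powr (1 / n)"
  shows "c $ i * (\<Sum>j\<in>UNIV. (A $ i $ j)\<^sup>2 * d $ j) = weight A c d / n"
proof -
  let ?R = "\<lambda>i. \<Sum>j\<in>UNIV. (A $ i $ j)\<^sup>2 * d $ j"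
  let ?r = "c $ i * ?R i"
  define Q where "Q = (\<kappa> * (\<Prod>i\<in>UNIV. c $ i)) powr (1 / n)"
  have prod: "0 < (\<Prod>i\<in>UNIV. c $ i)" using c by (intro prod_pos) (simp add: pos_vec_def)
  with \<kappa> have "0 < \<kappa> * (\<Prod>i\<in>UNIV. c $ i)" by (rule mult_pos_pos)
  then have Q: "0 < Q" unfolding Q_def powr_gt_zero by (rule less_imp_neq[symmetric])
  have "0 \<le> c $ i" "0 \<le> d $ i" for i
    using c d by (auto simp: pos_vec_def less_imp_le)
  then have T: "0 \<le> weight A c d"
    unfolding weight_def by (intro sum_nonneg mult_nonneg_nonneg) auto
  have "weight A c d / n * s \<le> ?r * (exp s - 1)" for s
  proof -
    define c' where "c' = (\<chi> k. if k = i then exp s * c $ k else c $ k)"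
    have "pos_vec c'" using c by (simp add: pos_vec_def c'_def)
    have "weight A c' d = (\<Sum>k\<in>UNIV. c $ k * ?R k + (if k = i then (exp s - 1) * ?r else 0))"
      unfolding weight_def by (intro sum.cong) (auto simp: c'_def algebra_simps)
    then have w: "weight A c' d = weight A c d + (exp s - 1) * ?r"
      by (simp add: sum.distrib weight_def)
    have "(\<Prod>k\<in>UNIV. c' $ k) = (\<Prod>k\<in>UNIV. c $ k * (if k = i then exp s else 1))"
      by (intro prod.cong) (auto simp: c'_def)
    then have "(\<Prod>k\<in>UNIV. c' $ k) = (\<Prod>k\<in>UNIV. c $ k) * exp s" by (simp add: prod.distrib)
    then have "(\<kappa> * (\<Prod>k\<in>UNIV. c' $ k)) powr (1 / n) = Q * exp (s / n)"
      using prod \<kappa> by (simp add: Q_def powr_mult exp_powr_real flip: mult.assoc)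
    then have "weight A c d / Q \<le> (weight A c d + (exp s - 1) * ?r) / (Q * exp (s / n))"
      using min[OF \<open>pos_vec c'\<close>] by (simp add: w Q_def)
    then have "weight A c d * exp (s / n) \<le> weight A c d + (exp s - 1) * ?r"
      using Q by (simp add: field_simps)
    \<comment> \<open>The tangent bound replaces \<open>exp (s / n)\<close> by a linear term, as
      \<open>eq_if_linear_le_exp\<close> requires.\<close>
    moreover have "weight A c d * (1 + s / n) \<le> weight A c d * exp (s / n)"
      by (intro mult_left_mono T exp_ge_add_one_self)
    ultimately show ?thesis by (simp add: algebra_simps)
  qed
  then show ?thesis using eq_if_linear_le_exp[of "weight A c d / n" ?r] by simp
qed

text \<open>Varying \<open>c\<close> and varying \<open>d\<close> give the same constant, since the
  weight is unchanged when the matrix is transposed and \<open>c\<close> and \<open>d\<close> are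
  exchanged.\<close>

lemma arg_min_scaling_condition:
  fixes A :: "real^'n^'n"
  assumes A: "det A \<noteq> 0"
    and arg: "is_arg_min (\<lambda>(c, d). scaled_omega A c d) (\<lambda>(c, d). pos_vec c \<and> pos_vec d) (c, d)"
  shows "scaling_condition A (Diag c) (Diag d)"
proof -
  let ?n = "real CARD('n)"
  have pos: "pos_vec c" "pos_vec d" using arg by (auto simp: is_arg_min_def)
  have min: "scaled_omega A c d \<le> scaled_omega A c' d'" if "pos_vec c'" "pos_vec d'" for c' d'
    using arg that by (force simp: is_arg_min_def not_less)
  have prod: "0 < (\<Prod>i\<in>UNIV. c $ i)" "0 < (\<Prod>j\<in>UNIV. d $ j)"
    using pos by (auto simp: pos_vec_def intro: prod_pos)
  have rows: "c $ i * (\<Sum>j\<in>UNIV. (A $ i $ j)\<^sup>2 * d $ j) = weight A c d / ?n" for i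
  \<comment> \<open>\<kappa> gathers the factors of the determinant that do not depend on
    \<open>c\<close>.\<close>
  proof (rule minimizer_row_sums[OF pos, of "(det A)\<^sup>2 * (\<Prod>j\<in>UNIV. d $ j)"])
    show "0 < (det A)\<^sup>2 * (\<Prod>j\<in>UNIV. d $ j)" using A prod by simp
  qed (use min[OF _ pos(2)] in \<open>simp add: scaled_omega_eq pos divide_le_cancel del: divide_divide_eq_left\<close>)
  have cols: "d $ j * (\<Sum>i\<in>UNIV. (transpose A $ j $ i)\<^sup>2 * c $ i) = weight (transpose A) d c / ?n" for j
  proof (rule minimizer_row_sums[OF pos(2,1), of "(det A)\<^sup>2 * (\<Prod>i\<in>UNIV. c $ i)"])
    show "0 < (det A)\<^sup>2 * (\<Prod>i\<in>UNIV. c $ i)" using A prod by simp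
  qed (use min[OF pos(1)] in \<open>simp add: scaled_omega_eq pos weight_transpose divide_le_cancel ac_simps del: divide_divide_eq_left\<close>)
  \<comment> \<open>Nonsingularity yields a nonzero entry, which makes the common constant
    positive.\<close>
  have "row i A \<noteq> 0" for i
    using A det_zero_row(2) by blast
  then obtain i j where ij: "A $ i $ j \<noteq> 0" by (fastforce simp: vec_eq_iff row_def)
  have "0 < (\<Sum>j\<in>UNIV. (A $ i $ j)\<^sup>2 * d $ j)"
    using ij pos(2) by (intro sum_pos2[of _ j]) (auto simp: pos_vec_def less_imp_le)
  then have "0 < weight A c d / ?n"
    using pos(1) by (simp flip: rows[of i] add: pos_vec_def)
  then show ?thesis
    using rows cols[unfolded weight_transpose]
    by (intro scaling_condition_Diag[of "weight A c d / ?n"]) (auto simp: transpose_def)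
qed

theorem theorem3p9:
  fixes A :: "real^'n^'n"
  assumes "invertible A"
    and "total_support (hadamard A A)"
  shows "(\<forall>k. sk_iter A k =
            Diag (\<chi> i. \<Prod>j=1..k. sk_sqrt_c A j $ i) ** A ** Diag (\<chi> i. \<Prod>j=1..k. sk_sqrt_d A j $ i))
    \<and> (\<exists>C D :: real^'n^'n. pos_diagonal C \<and> pos_diagonal D
        \<and> (let Abar = diag_sqrt C ** A ** diag_sqrt D in
             converges_linearly (sk_iter A) Abar
             \<and> (\<forall>i. norm (row i Abar) = 1) \<and> (\<forall>j. norm (column j Abar) = 1))
        \<and> scaling_condition A C D)
    \<and> (\<forall>c d :: real^'n.
         is_arg_min (\<lambda>(c, d). scaled_omega A c d) (\<lambda>(c, d). pos_vec c \<and> pos_vec d) (c, d)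
         \<longrightarrow> scaling_condition A (Diag c) (Diag d))"
proof (intro conjI allI impI)
  show "sk_iter A k =
      Diag (\<chi> i. \<Prod>j=1..k. sk_sqrt_c A j $ i) ** A ** Diag (\<chi> i. \<Prod>j=1..k. sk_sqrt_d A j $ i)" for k
    by (rule sk_iter_eq_scaling)
next
  obtain u v where uv: "\<And>i. row_sum (hadamard A A) u v i = 1"
      "\<And>j. row_sum (transpose (hadamard A A)) v u j = 1"
    using total_support_ex_scaling[OF assms(2)] by blast
  define R where "R = rescale A u v"
  define C D :: "real^'n^'n" where "C = Diag (\<chi> i. exp (u $ i))" and "D = Diag (\<chi> j. exp (v $ j))"
  have sqrt_exp: "sqrt (exp x) = exp (x / 2)" for x :: real
    by (rule real_sqrt_unique) (simp_all add: exp_half_square)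
  have R: "diag_sqrt C ** A ** diag_sqrt D = R"
    by (simp add: vec_eq_iff C_def D_def diag_sqrt_Diag mult_Diag_component Diag_mult_component
        R_def rescale_def sqrt_exp add_divide_distrib exp_add)
  have RR: "hadamard R R $ i $ j = hadamard A A $ i $ j * exp (u $ i + v $ j)" for i j
    by (simp add: R_def rescale_def hadamard_def flip: power2_eq_square)
      (simp add: power_mult_distrib exp_half_square)
  have ds: "doubly_stochastic (hadamard R R)"
    unfolding doubly_stochastic_def RR using uv
    by (auto simp: row_sum_transpose row_sum_def[of "hadamard A A"]) (simp add: hadamard_def)
  \<comment> \<open>Scaling the limit back recovers \<open>A\<close>, so the iteration is that of
    \<open>R\<close> started from the exponents \<open>- u\<close> and \<open>- v\<close>.\<close>
  have A: "A = rescale R (- u) (- v)"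
    by (simp add: vec_eq_iff R_def rescale_def mult.assoc flip: exp_add add_divide_distrib)
  have "converges_linearly (sk_iter A) R"
    using sk_iter_rescale_converges[OF ds, of "- u" "- v"] by (simp flip: A)
  moreover have "norm (row i R) = 1" "norm (column i R) = 1" for i
    by (simp_all add: R_def norm_row_rescale norm_column_rescale uv)
  moreover have "scaling_condition A C D"
    unfolding C_def D_def
  \<comment> \<open>The expressions are the squared row and column norms of \<open>R\<close>, so the
    constant is 1.\<close>
  proof (rule scaling_condition_Diag[of 1])
    show "(\<chi> i. exp (u $ i)) $ i * (\<Sum>j\<in>UNIV. (A $ i $ j)\<^sup>2 * (\<chi> j. exp (v $ j)) $ j) = 1" for i
      using uv(1)[of i]
      by (simp add: row_sum_def hadamard_def exp_add sum_distrib_left power2_eq_square ac_simps)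
    show "(\<chi> j. exp (v $ j)) $ j * (\<Sum>i\<in>UNIV. (A $ i $ j)\<^sup>2 * (\<chi> i. exp (u $ i)) $ i) = 1" for j
      using uv(2)[of j]
      by (simp add: row_sum_transpose hadamard_def exp_add sum_distrib_left power2_eq_square ac_simps)
  qed simp
  moreover have "pos_diagonal C" "pos_diagonal D"
    by (auto simp: C_def D_def pos_diagonal_def pos_vec_def diag_def Diag_def)
  ultimately show "\<exists>C D :: real^'n^'n. pos_diagonal C \<and> pos_diagonal D
        \<and> (let Abar = diag_sqrt C ** A ** diag_sqrt D in
             converges_linearly (sk_iter A) Abar
             \<and> (\<forall>i. norm (row i Abar) = 1) \<and> (\<forall>j. norm (column j Abar) = 1))
        \<and> scaling_condition A C D"
    unfolding Let_def R[symmetric] by blast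
next
  show "scaling_condition A (Diag c) (Diag d)"
    if "is_arg_min (\<lambda>(c, d). scaled_omega A c d) (\<lambda>(c, d). pos_vec c \<and> pos_vec d) (c, d)" for c d
    using assms(1) that by (intro arg_min_scaling_condition) (simp_all add: invertible_det_nz)
qed

end
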